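(* Let $P,Q,R\in\mathbb{C}[x]$ be polynomials not divisible by $x$. Then: 1. $\widetilde{P}\diamond\widetilde{Q}=\widetilde{Q\diamond P}$. 2. $(P\diamond Q)\diamond R=P\diamond(Q\diamond R)$.
   Context: Only polynomials $P$ with $x\nmid P(x)$ are considered. Such a $P\in\mathbb{C}[x]$ of degree $n$ is written $P(x)=\sum_{k=0}^{n}a_{n-k}x^{n-k}$, and $C(P)=1+\deg P=n+1$ denotes its number of coefficients. The Reversing of $P$ is $\widetilde{P}(x)=\sum_{k=0}^{n}b_{n-k}x^{n-k}$ with $b_{n-k}=a_k$ for $k=0,\dots,n$. The Pasting of polynomials $P$ and $Q$ is $P\diamond Q=x^{C(Q)}P+Q$. *)

theory Defs
  imports Complex_Main "HOL-Computational_Algebra.Polynomial"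
begin

text \<open>The Reversing of \<open>P\<close> is the library's \<^const>\<open>reflect_poly\<close>: by
  \<open>coeff_reflect_poly\<close>, the coefficient of \<open>x^(n - k)\<close> in \<open>reflect_poly P\<close>, for
  \<open>n = degree P\<close> and \<open>k \<le> n\<close>, is the coefficient of \<open>x^k\<close> in \<open>P\<close>.\<close>

definition num_coeffs :: "complex poly \<Rightarrow> nat" where
  "num_coeffs P = 1 + degree P"

definition pasting :: "complex poly \<Rightarrow> complex poly \<Rightarrow> complex poly"  (infixl \<open>\<diamondop>\<close> 65) where
  "P \<diamondop> Q = monom 1 (num_coeffs Q) * P + Q"

end

theory Submission
  imports Defs
begin

text \<open>Pasting concatenates coefficient lists: multiplying \<open>P\<close> by
  \<open>x^(num_coeffs Q)\<close> moves it just past the top coefficient of \<open>Q\<close>, so the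
  two blocks never overlap (\<open>coeff_pasting\<close>) and lengths add
  (\<open>num_coeffs_pasting\<close>). Reversing a concatenation reverses each block and swaps them
  (\<open>reflect_poly_pasting\<close>), and concatenation is associative
  (\<open>pasting_assoc\<close>).\<close>

lemma coeff_pasting:
  "coeff (P \<diamondop> Q) i = (if i \<le> degree Q then coeff Q i else coeff P (i - num_coeffs Q))"
  by (auto simp: pasting_def num_coeffs_def coeff_monom_mult coeff_eq_0)

lemma degree_pasting:
  assumes "P \<noteq> 0"
  shows "degree (P \<diamondop> Q) = degree P + num_coeffs Q"
proof (rule antisym)
  show "degree (P \<diamondop> Q) \<le> degree P + num_coeffs Q"
    by (rule degree_le) (auto simp: coeff_pasting num_coeffs_def coeff_eq_0)
  show "degree P + num_coeffs Q \<le> degree (P \<diamondop> Q)"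
    using assms by (intro le_degree) (simp add: coeff_pasting num_coeffs_def)
qed

lemma num_coeffs_pasting:
  assumes "P \<noteq> 0"
  shows "num_coeffs (P \<diamondop> Q) = num_coeffs P + num_coeffs Q"
  using degree_pasting[OF assms] by (simp add: num_coeffs_def)

text \<open>A nonzero constant coefficient keeps the degree unchanged under
  \<open>reflect_poly\<close>, so the reversed blocks retain their lengths.\<close>

lemma reflect_poly_pasting:
  assumes "coeff P 0 \<noteq> 0" and "coeff Q 0 \<noteq> 0"
  shows "reflect_poly (Q \<diamondop> P) = reflect_poly P \<diamondop> reflect_poly Q"
proof (rule poly_eqI)
  fix i
  have "Q \<noteq> 0"
    using assms by auto
  then show "coeff (reflect_poly (Q \<diamondop> P)) i = coeff (reflect_poly P \<diamondop> reflect_poly Q) i"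
    using assms
    \<comment> \<open>Both sides read the same block at position \<open>i\<close>;
      \<open>arg_cong\<close> leaves only equality of the indices, e.g. \<open>degree Q - i\<close>
      when \<open>i \<le> degree Q\<close>.\<close>
    by (auto simp: coeff_pasting coeff_reflect_poly degree_pasting num_coeffs_def
        intro: arg_cong[where f = "coeff _"])
qed

text \<open>Both sides expand to \<open>x^(num_coeffs Q + num_coeffs R) * P + x^(num_coeffs R) * Q +
  R\<close>. For \<open>Q = 0\<close> the lengths would not add.\<close>

lemma pasting_assoc:
  assumes "Q \<noteq> 0"
  shows "(P \<diamondop> Q) \<diamondop> R = P \<diamondop> (Q \<diamondop> R)"
proof -
  have "monom 1 (num_coeffs (Q \<diamondop> R)) = monom (1::complex) (num_coeffs R) * monom 1 (num_coeffs Q)"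
    by (simp add: num_coeffs_pasting[OF assms] mult_monom add.commute)
  then show ?thesis
    by (simp add: pasting_def algebra_simps)
qed

theorem proposition2p11:
  fixes P Q R :: "complex poly"
  assumes "\<not> [:0, 1:] dvd P" and "\<not> [:0, 1:] dvd Q" and "\<not> [:0, 1:] dvd R"
  shows "reflect_poly P \<diamondop> reflect_poly Q = reflect_poly (Q \<diamondop> P)
    \<and> (P \<diamondop> Q) \<diamondop> R = P \<diamondop> (Q \<diamondop> R)"
proof -
  \<comment> \<open>Factor theorem at the root 0: \<open>x\<close> divides a polynomial iff its
    value at 0, the constant coefficient, vanishes.\<close>
  have "coeff P 0 \<noteq> 0" "coeff Q 0 \<noteq> 0"
    using assms poly_eq_0_iff_dvd[of P 0] poly_eq_0_iff_dvd[of Q 0] by (auto simp: poly_0_coeff_0)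
  moreover have "Q \<noteq> 0"
    using assms(2) by auto
  ultimately show ?thesis
    by (simp add: reflect_poly_pasting pasting_assoc)
qed

end
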